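(* Let $X$ be a connected graph with a chosen basepoint $x_0$. Let $A$ be the set of atoms of $X$ and let $i\colon A\to Z_1(X,\mathbb{R})$ be the map $i(\llbracket\alpha\rrbracket)=\pi(c_\alpha)$. Then the following are equivalent: (1) $X$ is bridgeless. (2) The map $i\colon A\to Z_1(X,\mathbb{R})$ is one-to-one.
   Context: Graphs. A graph $X=(E,V,s,t,\mathrm{inv})$ consists of a set $V$ of vertices, a set $E$ of edges, source and target maps $s,t\colon E\to V$, and a map $\mathrm{inv}\colon E\to E$, $e\mapsto e^{-1}$, with $s(e^{-1})=t(e)$, $t(e^{-1})=s(e)$, $(e^{-1})^{-1}=e$ and $e^{-1}\neq e$ for all $e$. Write $e\colon v\to w$ if $s(e)=v$, $t(e)=w$. (Multiple edges and self-loops are allowed.) An edge $e$ of a graph is a bridge if removing it (together with $e^{-1}$, which represents the same undirected edge) disconnects the graph; a graph is bridgeless if none of its edges are bridges. Paths. A path $\gamma\colon x\to y$ is a word of edges $\gamma=e_1\cdots e_\ell$ with $e_k\colon v_{k-1}\to v_k$, $v_0=x$, $v_\ell=y$; the empty word is allowed iff $x=y$ (trivial path). A loop based at $x$ is a path $x\to x$. Two paths are homologous if one can be obtained from the other by finitely many moves of the following types: introducing or deleting a subword $e e^{-1}$; replacing a subword $\lambda\mu$ by $\mu\lambda$, where $\lambda,\mu$ are loops based at the same vertex. $\llbracket\gamma\rrbracket$ denotes the homology class of $\gamma$. The set of atoms is $A=\{\llbracket\alpha\rrbracket : \alpha\colon x_0\to x \text{ a path, for some } x\in V\}$. Chains.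 $C_0(X,\mathbb{Z})$ is the free abelian group on $V$; $C_1(X,\mathbb{Z})$ is the free abelian group on $E$ modulo the relations $e^{-1}=-e$; $\partial e=t(e)-s(e)$. $C_k(X,\mathbb{R})=C_k(X,\mathbb{Z})\otimes\mathbb{R}$, and $Z_1(X,\mathbb{R})=\ker(\partial\colon C_1(X,\mathbb{R})\to C_0(X,\mathbb{R}))$. $C_1(X,\mathbb{R})$ has the inner product for which edges form an orthonormal basis (one edge chosen from each pair $\{e,e^{-1}\}$, with $e^{-1}=-e$), and $\pi\colon C_1(X,\mathbb{R})\to Z_1(X,\mathbb{R})$ is the orthogonal projection. For a path $\gamma=e_1\cdots e_n$, $c_\gamma=e_1+\cdots+e_n$. Homologous paths give the same 1-chain, so $i$ is well-defined. *)

theory Defs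
  imports
    Complex_Main
    "HOL-Library.Poly_Mapping"
    "Graph_Theory.Graph_Theory"
begin

text \<open>
  A graph with edge inversion is a \<^locale>\<open>bidirected_digraph\<close> \<open>G\<close>, with \<open>arev e\<close> the inverse of
  the edge \<open>e\<close>; the locale sets \<open>arev e = e\<close> outside \<^term>\<open>arcs G\<close>, which is only a totality
  convention. Neither the vertex set nor the edge set is assumed to be finite.
\<close>

context bidirected_digraph
begin

text \<open>To be read in a connected graph, where ``disconnects'' means ``is no longer connected''.\<close>

definition bridge :: "'b \<Rightarrow> bool" where
  "bridge e \<longleftrightarrow>
     e \<in> arcs G \<and> \<not> Digraph_Component.connected (pre_digraph.del_arc (del_arc e) (arev e))"

definition bridgeless :: bool where
  "bridgeless \<longleftrightarrow> (\<forall>e \<in> arcs G. \<not> bridge e)"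

text \<open>
  A path is a triple \<open>(x, p, y)\<close> with \<^term>\<open>awalk x p y\<close>: the endpoints are recorded because the
  trivial paths at different vertices are the same (empty) word.
\<close>

inductive homology_move :: "'a \<times> 'b list \<times> 'a \<Rightarrow> 'a \<times> 'b list \<times> 'a \<Rightarrow> bool" where
  cancel: "awalk x (p @ [e, arev e] @ q) y \<Longrightarrow>
    homology_move (x, p @ [e, arev e] @ q, y) (x, p @ q, y)"
| swap: "awalk x p v \<Longrightarrow> awalk v l v \<Longrightarrow> awalk v m v \<Longrightarrow> awalk v q y \<Longrightarrow>
    homology_move (x, p @ l @ m @ q, y) (x, p @ m @ l @ q, y)"

definition homologous :: "'a \<times> 'b list \<times> 'a \<Rightarrow> 'a \<times> 'b list \<times> 'a \<Rightarrow> bool" where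
  "homologous = equivclp homology_move"

definition homology_class :: "'a \<times> 'b list \<times> 'a \<Rightarrow> ('a \<times> 'b list \<times> 'a) set" where
  "homology_class \<gamma> = {\<delta>. homologous \<gamma> \<delta>}"

definition atoms :: "'a \<Rightarrow> ('a \<times> 'b list \<times> 'a) set set" where
  "atoms x\<^sub>0 = {homology_class (x\<^sub>0, \<alpha>, x) |\<alpha> x. awalk x\<^sub>0 \<alpha> x}"

text \<open>
  Modulo the relations \<open>arev e = - e\<close>, the free real vector space on the edges is modelled by the
  finitely supported antisymmetric functions on the edges: the class of the edge \<open>e\<close> is
  \<open>edge_chain e\<close>, and \<^term>\<open>Poly_Mapping.lookup c e\<close> is the coefficient
  of \<open>e\<close> in \<open>c\<close>, for any choice of one edge from each pair that contains \<open>e\<close>. Sums over such a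
  choice are written as sums over all edges, with a factor 1/2 because each pair is counted twice.
\<close>

definition C1 :: "('b \<Rightarrow>\<^sub>0 real) set" where
  "C1 = {c. Poly_Mapping.keys c \<subseteq> arcs G \<and>
     (\<forall>e \<in> arcs G. Poly_Mapping.lookup c (arev e) = - Poly_Mapping.lookup c e)}"

definition edge_chain :: "'b \<Rightarrow> 'b \<Rightarrow>\<^sub>0 real" where
  "edge_chain e = Poly_Mapping.single e 1 - Poly_Mapping.single (arev e) 1"

definition boundary :: "('b \<Rightarrow>\<^sub>0 real) \<Rightarrow> 'a \<Rightarrow>\<^sub>0 real" where
  "boundary c = (\<Sum>e \<in> Poly_Mapping.keys c.
     Poly_Mapping.single (head G e) (Poly_Mapping.lookup c e / 2)
     - Poly_Mapping.single (tail G e) (Poly_Mapping.lookup c e / 2))"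

definition Z1 :: "('b \<Rightarrow>\<^sub>0 real) set" where
  "Z1 = {c \<in> C1. boundary c = 0}"

definition chain_inner :: "('b \<Rightarrow>\<^sub>0 real) \<Rightarrow> ('b \<Rightarrow>\<^sub>0 real) \<Rightarrow> real" where
  "chain_inner c d =
     (\<Sum>e \<in> Poly_Mapping.keys c. Poly_Mapping.lookup c e * Poly_Mapping.lookup d e) / 2"

text \<open>
  \<open>\<pi>\<close> is the orthogonal projection of \<open>C1\<close> onto \<open>Z1\<close>. It is unique on \<open>C1\<close>, and it exists when the
  graph is finite (see \<open>orthogonal_projection_exists\<close> below); when \<open>C1\<close> has infinite dimension,
  existence can fail.
\<close>

definition orthogonal_projection :: "(('b \<Rightarrow>\<^sub>0 real) \<Rightarrow> 'b \<Rightarrow>\<^sub>0 real) \<Rightarrow> bool" where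
  "orthogonal_projection \<pi> \<longleftrightarrow>
     (\<forall>c \<in> C1. \<pi> c \<in> Z1 \<and> (\<forall>z \<in> Z1. chain_inner (c - \<pi> c) z = 0))"

fun path_chain :: "'a \<times> 'b list \<times> 'a \<Rightarrow> 'b \<Rightarrow>\<^sub>0 real" where
  "path_chain (x, p, y) = (\<Sum>e \<leftarrow> p. edge_chain e)"

text \<open>
  The image is a singleton, since homologous paths have the same chain; see
  \<open>atom_position_homology_class\<close>.
\<close>

definition atom_position ::
    "(('b \<Rightarrow>\<^sub>0 real) \<Rightarrow> 'b \<Rightarrow>\<^sub>0 real) \<Rightarrow> ('a \<times> 'b list \<times> 'a) set \<Rightarrow> 'b \<Rightarrow>\<^sub>0 real" where
  "atom_position \<pi> a = the_elem ((\<lambda>\<gamma>. \<pi> (path_chain \<gamma>)) ` a)"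


lemma edge_chain_arev: "edge_chain (arev e) = - edge_chain e"
  by (simp add: edge_chain_def)

lemma lookup_edge_chain:
  "Poly_Mapping.lookup (edge_chain e) f = (if e = f then 1 else 0) - (if arev e = f then 1 else 0)"
  by (simp add: edge_chain_def lookup_minus lookup_single when_def)

lemma keys_edge_chain: "e \<in> arcs G \<Longrightarrow> Poly_Mapping.keys (edge_chain e) = {e, arev e}"
  using arev_neq[of e] by (auto simp: in_keys_iff lookup_edge_chain split: if_splits)

lemma edge_chain_in_C1: "e \<in> arcs G \<Longrightarrow> edge_chain e \<in> C1"
  by (auto simp: C1_def keys_edge_chain lookup_edge_chain arev_eq_iff)

lemma boundary_edge_chain:
  assumes "e \<in> arcs G"
  shows "boundary (edge_chain e)
    = Poly_Mapping.single (head G e) 1 - Poly_Mapping.single (tail G e) 1"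
proof -
  have "arev e \<noteq> e" using assms by (rule arev_neq)
  then show ?thesis
    using assms
    by (auto intro!: poly_mapping_eqI
        simp: boundary_def keys_edge_chain lookup_edge_chain lookup_add lookup_minus
        lookup_single when_def)
qed

lemma chain_inner_edge_chain:
  assumes "e \<in> arcs G" "f \<in> arcs G"
  shows "chain_inner (edge_chain e) (edge_chain f)
    = (if f = e then 1 else if f = arev e then -1 else 0)"
proof -
  have "arev e \<noteq> e" "arev f \<noteq> f" using assms by (auto dest: arev_neq)
  then show ?thesis
    using assms arev_arev
    by (auto simp: chain_inner_def keys_edge_chain lookup_edge_chain arev_eq_iff)
qed

lemma path_chain_homologous:
  assumes "homologous \<gamma> \<delta>"
  shows "path_chain \<gamma> = path_chain \<delta>"
proof -
  have move: "path_chain \<gamma> = path_chain \<delta>" if "homology_move \<gamma> \<delta>" for \<gamma> \<delta>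
    using that by cases (simp_all add: edge_chain_arev)
  show ?thesis
    using assms unfolding homologous_def
    by (induction rule: equivclp_induct) (auto dest: move)
qed

lemma atom_position_homology_class:
  "atom_position \<pi> (homology_class \<gamma>) = \<pi> (path_chain \<gamma>)"
proof -
  have "\<gamma> \<in> homology_class \<gamma>"
    by (simp add: homology_class_def homologous_def)
  then have "(\<lambda>\<gamma>. \<pi> (path_chain \<gamma>)) ` homology_class \<gamma> = {\<pi> (path_chain \<gamma>)}"
    by (auto simp: homology_class_def dest: path_chain_homologous)
  then show ?thesis
    by (simp add: atom_position_def)
qed

lemma atoms_eq_quotient:
  "atoms x\<^sub>0 = {(x\<^sub>0, \<alpha>, x) |\<alpha> x. awalk x\<^sub>0 \<alpha> x} // {(\<gamma>, \<delta>). homologous \<gamma> \<delta>}"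
  by (auto simp: atoms_def quotient_def homology_class_def)

lemma chain_inner_superset:
  assumes "finite S" "Poly_Mapping.keys c \<subseteq> S"
  shows "chain_inner c d = (\<Sum>e \<in> S. Poly_Mapping.lookup c e * Poly_Mapping.lookup d e) / 2"
  unfolding chain_inner_def
  using assms by (auto intro!: sum.mono_neutral_left simp: in_keys_iff)

lemma boundary_superset:
  assumes "finite S" "Poly_Mapping.keys c \<subseteq> S"
  shows "boundary c = (\<Sum>e \<in> S.
     Poly_Mapping.single (head G e) (Poly_Mapping.lookup c e / 2)
     - Poly_Mapping.single (tail G e) (Poly_Mapping.lookup c e / 2))"
  unfolding boundary_def
  using assms by (auto intro!: sum.mono_neutral_left simp: in_keys_iff)

lemma orthogonal_projection_exists:
  assumes fin: "finite (arcs G)"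
  shows "\<exists>\<pi>. orthogonal_projection \<pi>"
proof -
  define sc where "sc = (\<lambda>(r::real) (c :: 'b \<Rightarrow>\<^sub>0 real). Poly_Mapping.map ((*) r) c)"
  have lsc[simp]: "Poly_Mapping.lookup (sc r c) e = r * Poly_Mapping.lookup c e" for r c e
    by (auto simp: sc_def Poly_Mapping.map.rep_eq when_def)
  interpret vs: vector_space sc
    by unfold_locales
      (auto intro!: poly_mapping_eqI simp: lookup_add algebra_simps)
  have keys_sc: "Poly_Mapping.keys (sc r c) \<subseteq> Poly_Mapping.keys c" for r c
    by (auto simp: in_keys_iff)
  define I where "I = (\<lambda>c d :: 'b \<Rightarrow>\<^sub>0 real.
    (\<Sum>e \<in> arcs G. Poly_Mapping.lookup c e * Poly_Mapping.lookup d e) / 2)"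
  have I: "chain_inner c d = I c d" if "c \<in> C1" for c d
    using that fin by (simp add: I_def C1_def chain_inner_superset)
  have I_minus: "I (c - c') d = I c d - I c' d"
    and I_sc: "I (sc r c) d = r * I c d" and I_scr: "I c (sc r d) = r * I c d"
    and I_addr: "I c (d + d') = I c d + I c d'" and I_zr: "I c 0 = 0"
    and I_sym: "I c d = I d c" for c c' d d' r
    by (simp_all add: I_def lookup_add lookup_minus algebra_simps sum.distrib sum_subtractf
        sum_distrib_left diff_divide_distrib add_divide_distrib sum_divide_distrib)
  have C1_keys: "Poly_Mapping.keys c \<subseteq> arcs G" if "c \<in> C1" for c using that by (simp add: C1_def)
  have C1_minus: "c - d \<in> C1" if "c \<in> C1" "d \<in> C1" for c d
    using that keys_diff[of c d] by (auto simp: C1_def lookup_minus)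
  have bd0: "boundary (0 :: 'b \<Rightarrow>\<^sub>0 real) = 0" by (simp add: boundary_def)
  have sub: "vs.subspace Z1"
  proof (rule vs.subspaceI)
    show "0 \<in> Z1" by (simp add: Z1_def C1_def bd0)
  next
    fix c d assume cd: "c \<in> Z1" "d \<in> Z1"
    then have C: "c + d \<in> C1"
      using Poly_Mapping.keys_add[of c d] by (auto simp: Z1_def C1_def lookup_add)
    have "Poly_Mapping.lookup (boundary (c + d)) v
        = Poly_Mapping.lookup (boundary c) v + Poly_Mapping.lookup (boundary d) v" for v
    proof -
      have "c \<in> C1" "d \<in> C1" using cd by (simp_all add: Z1_def)
      with C show ?thesis
        by (auto simp: boundary_superset[OF fin C1_keys] lookup_sum lookup_minus lookup_single
            lookup_add sum.distrib[symmetric] when_def add_divide_distrib intro!: sum.cong)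
    qed
    then have "boundary (c + d) = 0"
      using cd by (intro poly_mapping_eqI) (simp add: Z1_def)
    then show "c + d \<in> Z1" using cd C by (simp add: Z1_def)
  next
    fix r c assume c: "c \<in> Z1"
    then have C: "sc r c \<in> C1"
      using keys_sc[of r c] by (auto simp: Z1_def C1_def)
    have "Poly_Mapping.lookup (boundary (sc r c)) v = r * Poly_Mapping.lookup (boundary c) v" for v
    proof -
      have "c \<in> C1" using c by (simp add: Z1_def)
      with C show ?thesis
        by (auto simp: boundary_superset[OF fin C1_keys] lookup_sum lookup_minus lookup_single
            sum_distrib_left when_def intro!: sum.cong)
    qed
    then have "boundary (sc r c) = 0"
      using c by (intro poly_mapping_eqI) (simp add: Z1_def)
    then show "sc r c \<in> Z1" using C by (simp add: Z1_def)
  qed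
  have Gram_Schmidt: "\<exists>z \<in> vs.span B. \<forall>b \<in> B. I (c - z) b = 0" if "finite B" for B c
    using that
  proof (induction B arbitrary: c)
    case empty
    show ?case by (intro bexI[of _ 0]) (auto simp: vs.span_zero)
  next
    case (insert b B)
    obtain w where w: "w \<in> vs.span B" "\<forall>x \<in> B. I (b - w) x = 0"
      using insert.IH[of b] by auto
    obtain z where z: "z \<in> vs.span B" "\<forall>x \<in> B. I (c - z) x = 0"
      using insert.IH[of c] by auto
    have orth: "I u x = 0" if "\<forall>x \<in> B. I u x = 0" "x \<in> vs.span B" for u x
      using that(2) by (induction rule: vs.span_induct_alt)
        (auto simp: I_zr I_addr I_scr that(1))
    define b' where "b' = b - w"
    have b_eq: "b = b' + w" by (simp add: b'_def)
    show ?case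
    proof (cases "I b' b' = 0")
      case True
      have "Poly_Mapping.lookup b' e = 0" if "e \<in> arcs G" for e
        using True that fin
        by (auto simp: I_def sum_nonneg_eq_0_iff)
      then have "I (c - z) b' = 0" by (simp add: I_def)
      then have "I (c - z) b = 0"
        using orth[OF z(2) w(1)] by (simp add: b_eq I_addr)
      then show ?thesis
        using z vs.span_mono[of B "insert b B"] by (intro bexI[of _ z]) auto
    next
      case False
      define r where "r = I (c - z) b' / I b' b'"
      define y where "y = z + sc r b'"
      have y: "c - y = (c - z) - sc r b'" by (simp add: y_def)
      have "I (c - y) b' = 0" using False by (simp add: y I_minus I_sc r_def)
      moreover have B: "\<forall>x \<in> B. I (c - y) x = 0"
        unfolding y I_minus[of "c - z"] I_sc using z w by (simp add: b'_def)
      ultimately have "I (c - y) b = 0"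
        using orth[OF B w(1)] by (simp add: b_eq I_addr)
      moreover have "y \<in> vs.span (insert b B)"
        unfolding y_def b'_def
        using z w vs.span_mono[of B "insert b B"]
        by (intro vs.span_add vs.span_scale vs.span_diff) (auto intro: vs.span_base)
      ultimately show ?thesis using B by auto
    qed
  qed
  obtain B where B: "B \<subseteq> Z1" "vs.independent B" "Z1 \<subseteq> vs.span B"
    using vs.basis_exists[of Z1] by metis
  have "Z1 \<subseteq> vs.span ((\<lambda>e. Poly_Mapping.single e 1) ` arcs G)"
  proof
    fix c assume "c \<in> Z1"
    then have "Poly_Mapping.keys c \<subseteq> arcs G" by (simp add: Z1_def C1_def)
    then have "c = (\<Sum>e \<in> arcs G. sc (Poly_Mapping.lookup c e) (Poly_Mapping.single e 1))"
      using fin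
      by (intro poly_mapping_eqI)
        (auto simp: lookup_sum lookup_single when_def if_distrib sum.delta in_keys_iff
          cong: if_cong)
    then show "c \<in> vs.span ((\<lambda>e. Poly_Mapping.single e 1) ` arcs G)"
      by (metis (no_types, lifting) imageI vs.span_base vs.span_scale vs.span_sum)
  qed
  then have "finite B"
    using vs.independent_span_bound[OF _ B(2)] B(1) fin by (metis finite_imageI order_trans)
  have span: "vs.span B = Z1"
    using B sub by (simp add: vs.span_minimal subset_antisym)
  have "\<exists>z \<in> Z1. \<forall>x \<in> Z1. chain_inner (c - z) x = 0" if c: "c \<in> C1" for c
  proof -
    obtain z where z: "z \<in> Z1" "\<forall>b \<in> B. I (c - z) b = 0"
      using Gram_Schmidt[OF \<open>finite B\<close>] span by metis
    have "I (c - z) x = 0" if "x \<in> vs.span B" for x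
      using that by (induction rule: vs.span_induct_alt) (auto simp: I_zr I_addr I_scr z(2))
    moreover have "c - z \<in> C1" using c z by (simp add: C1_minus Z1_def)
    ultimately show ?thesis using z(1) span by (intro bexI[of _ z]) (auto simp: I)
  qed
  then show ?thesis
    unfolding orthogonal_projection_def by metis
qed

end

end

theory Submission
  imports Defs
begin

text \<open>
  The map \<open>i\<close> is the composition of \<open>\<lbrakk>\<alpha>\<rbrakk> \<mapsto> c\<^sub>\<alpha>\<close> with the projection \<open>\<pi>\<close>. The first of these
  never loses information: for paths, the chain (together with the starting point) determines the
  end point, because \<open>\<partial>c\<^sub>\<alpha>\<close> is the end point minus the starting point, and it determines the
  homology class, because a path is homologous to a product of commuting based loops, one for each
  letter, with inverse letters giving inverse loops (\<open>homologous_if_chain_eq\<close>). So the question is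
  when \<open>\<pi>\<close> identifies the chains of two paths that start at \<open>x\<^sub>0\<close>, that is, when the
  difference \<open>c\<close> of two such chains is orthogonal to all cycles.

  If \<open>e\<close> is a bridge, then every cycle has coefficient 0 at \<open>e\<close>: its net flow through the cut
  that only \<open>e\<close> crosses must vanish (\<open>lookup_Z1_bridge\<close>). Hence \<open>\<pi> e = 0\<close>, and following a path to
  the tail of \<open>e\<close> by \<open>e\<close> gives another atom at the same position (\<open>bridge_collapses_atoms\<close>).

  Conversely, let \<open>c\<close> be integral and orthogonal to all cycles, with \<open>\<partial>c = y - x\<close>. Being orthogonal
  to cycles, \<open>c\<close> is the coboundary of a function \<open>f\<close> on the vertices
  (\<open>orthogonal_chain_potential\<close>), so \<open>\<langle>c, c\<rangle> = \<langle>f, \<partial>c\<rangle> = f y - f x\<close>, and this is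
  positive if \<open>c \<noteq> 0\<close>. Then the set \<open>{v. f v \<le> f x}\<close> separates \<open>x\<close> from \<open>y\<close>, and the flow of \<open>c\<close> out
  of it is exactly 1. An edge that leaves this set carries a positive integer flow, so there is only
  one such edge, and it is a bridge (\<open>bridgeless_orthogonal_chain_eq_0\<close>).

  All chains have finite support, so the flows are finite sums and the argument covers infinite
  graphs.
\<close>

section \<open>Bridges as one-edge cuts\<close>

text \<open>
  A set of vertices that no edge enters or leaves is a union of connected components.
\<close>

lemma (in wf_digraph) connected_iff_cut:
  "Digraph_Component.connected G \<longleftrightarrow> verts G \<noteq> {} \<and>
     (\<forall>S. (\<exists>u \<in> verts G. u \<in> S) \<and> (\<exists>v \<in> verts G. v \<notin> S) \<longrightarrow>
       (\<exists>e \<in> arcs G. (head G e \<in> S) \<noteq> (tail G e \<in> S)))"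
  (is "_ \<longleftrightarrow> _ \<and> ?cuts")
proof -
  let ?R = "rtrancl_on (verts G) ((arcs_ends G)\<^sup>s)"
  have step: "(u, v) \<in> (arcs_ends G)\<^sup>s \<longleftrightarrow>
      (\<exists>e \<in> arcs G. u = tail G e \<and> v = head G e \<or> u = head G e \<and> v = tail G e)" for u v
    by (force simp: symcl_def arcs_ends_conv)
  have "(\<forall>u \<in> verts G. \<forall>v \<in> verts G. (u, v) \<in> ?R) \<longleftrightarrow> ?cuts"
  proof
    assume R: "\<forall>u \<in> verts G. \<forall>v \<in> verts G. (u, v) \<in> ?R"
    show ?cuts
    proof (intro allI impI, elim conjE bexE, rule ccontr)
      fix S u v
      assume uv: "u \<in> verts G" "u \<in> S" "v \<in> verts G" "v \<notin> S"
        and no: "\<not> (\<exists>e \<in> arcs G. (head G e \<in> S) \<noteq> (tail G e \<in> S))"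
      have "(u, v) \<in> ?R" using R uv by blast
      then have "v \<in> S"
        by (induction rule: rtrancl_on_induct) (use uv no in \<open>auto simp: step\<close>)
      with uv show False by simp
    qed
  next
    assume cuts: ?cuts
    show "\<forall>u \<in> verts G. \<forall>v \<in> verts G. (u, v) \<in> ?R"
    proof (intro ballI, rule ccontr)
      fix u v assume uv: "u \<in> verts G" "v \<in> verts G" "(u, v) \<notin> ?R"
      have "(u, u) \<in> ?R" using uv by simp
      with uv cuts obtain e
        where e: "e \<in> arcs G" "((u, head G e) \<in> ?R) \<noteq> ((u, tail G e) \<in> ?R)"
        using cuts[rule_format, of "{w. (u, w) \<in> ?R}"] by auto
      have "(tail G e, head G e) \<in> (arcs_ends G)\<^sup>s" "(head G e, tail G e) \<in> (arcs_ends G)\<^sup>s"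
        using e(1) by (auto simp: step)
      with e show False
        by (meson rtrancl_on_into_rtrancl_on head_in_verts tail_in_verts)
    qed
  qed
  then show ?thesis by (simp add: connected_conv)
qed

context bidirected_digraph
begin

text \<open>
  A set that witnesses the disconnectedness of the graph without \<open>e\<close> is crossed by some edge of the
  connected graph, and \<open>e\<close> and its inverse are the only candidates.
\<close>

lemma bridge_iff_cut:
  assumes "Digraph_Component.connected G"
  shows "bridge e \<longleftrightarrow> e \<in> arcs G \<and> (\<exists>S. (head G e \<in> S) \<noteq> (tail G e \<in> S) \<and>
    (\<forall>a \<in> arcs G - {e, arev e}. head G a \<in> S \<longleftrightarrow> tail G a \<in> S))"
proof (cases "e \<in> arcs G")
  case True
  define H where "H = pre_digraph.del_arc (del_arc e) (arev e)"
  interpret D: wf_digraph "del_arc e" by (rule wf_digraph_del_arc)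
  interpret H: wf_digraph H unfolding H_def by (rule D.wf_digraph_del_arc)
  have H: "verts H = verts G" "arcs H = arcs G - {e, arev e}" "tail H = tail G" "head H = head G"
    by (auto simp: H_def pre_digraph.del_arc_simps)
  have ends: "head G e \<in> verts G" "tail G e \<in> verts G" using True by auto
  have "\<not> Digraph_Component.connected H \<longleftrightarrow> (\<exists>S. (head G e \<in> S) \<noteq> (tail G e \<in> S) \<and>
      (\<forall>a \<in> arcs H. head G a \<in> S \<longleftrightarrow> tail G a \<in> S))" (is "_ \<longleftrightarrow> ?cut")
  proof
    assume "\<not> Digraph_Component.connected H"
    then obtain S u v where S: "u \<in> verts G" "u \<in> S" "v \<in> verts G" "v \<notin> S"
      and no: "\<forall>a \<in> arcs H. head G a \<in> S \<longleftrightarrow> tail G a \<in> S"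
      using ends unfolding H.connected_iff_cut H by blast
    obtain a where a: "a \<in> arcs G" "(head G a \<in> S) \<noteq> (tail G a \<in> S)"
      using assms S unfolding connected_iff_cut by blast
    with no have "a = e \<or> a = arev e" by (auto simp: H)
    with a True have "(head G e \<in> S) \<noteq> (tail G e \<in> S)" by auto
    with no show ?cut by blast
  next
    assume ?cut
    then show "\<not> Digraph_Component.connected H"
      using ends unfolding H.connected_iff_cut H by blast
  qed
  with True show ?thesis by (simp add: bridge_def H_def[symmetric] H(2))
qed (simp add: bridge_def)

section \<open>Calculating with homologous paths\<close>

definition inv_path :: "'b list \<Rightarrow> 'b list" where
  "inv_path p = map arev (rev p)"

lemma inv_path_inv_path [simp]: "inv_path (inv_path p) = p"
  by (simp add: inv_path_def rev_map o_def)

lemma inv_path_simps [simp]: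
  "inv_path [] = []" "inv_path (e # p) = inv_path p @ [arev e]"
  "inv_path (p @ q) = inv_path q @ inv_path p"
  by (simp_all add: inv_path_def)

lemma awalk_ends_in_verts: "awalk x p y \<Longrightarrow> x \<in> verts G \<and> y \<in> verts G"
  by auto

text \<open>
  Below, the vertex at which a walk \<open>p @ q\<close> splits is always known, so walks are composed by
  \<open>awalk_appendI\<close> instead of being split at the computed vertex \<open>awlast u p\<close>.
\<close>

declare awalk_simps [simp] awalk_append_iff [simp del] awalkE' [rule del]

lemma awalk_inv_path: "awalk x p y \<Longrightarrow> awalk y (inv_path p) x"
  by (induction p arbitrary: x) (auto intro!: awalk_appendI)

lemma homologous_refl [simp]: "homologous \<gamma> \<gamma>"
  by (simp add: homologous_def)

lemma homologous_sym: "homologous \<gamma> \<delta> \<Longrightarrow> homologous \<delta> \<gamma>"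
  unfolding homologous_def by (rule equivclp_sym)

lemma homologous_trans [trans]:
  "homologous \<gamma> \<delta> \<Longrightarrow> homologous \<delta> \<epsilon> \<Longrightarrow> homologous \<gamma> \<epsilon>"
  unfolding homologous_def by (rule equivclp_trans)

lemma homology_class_eq_iff: "homology_class \<gamma> = homology_class \<delta> \<longleftrightarrow> homologous \<gamma> \<delta>"
proof
  assume "homology_class \<gamma> = homology_class \<delta>"
  moreover have "\<delta> \<in> homology_class \<delta>" by (simp add: homology_class_def)
  ultimately have "\<delta> \<in> homology_class \<gamma>" by simp
  then show "homologous \<gamma> \<delta>" by (simp add: homology_class_def)
next
  assume eq: "homologous \<gamma> \<delta>"
  show "homology_class \<gamma> = homology_class \<delta>"
    unfolding homology_class_def
    by (intro Collect_cong iffI) (erule homologous_trans[OF homologous_sym[OF eq]] homologous_trans[OF eq])+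
qed

text \<open>
  Moves act on subwords, so they can be carried out inside a longer path; thus homology is a
  congruence for concatenation (\<open>homologous_append\<close>).
\<close>

lemma homology_move_append:
  assumes "homology_move \<gamma> \<delta>"
  obtains x p q y where "\<gamma> = (x, p, y)" "\<delta> = (x, q, y)"
    "\<And>a l r b. awalk a l x \<Longrightarrow> awalk y r b \<Longrightarrow> homology_move (a, l @ p @ r, b) (a, l @ q @ r, b)"
  using assms
proof cases
  case (cancel x p e q y)
  show ?thesis
  proof (rule that[OF cancel(1,2)])
    fix a l r b assume "awalk a l x" "awalk y r b"
    then have "awalk a (l @ (p @ [e, arev e] @ q) @ r) b"
      using cancel(3) by (metis awalk_appendI)
    then have "awalk a ((l @ p) @ [e, arev e] @ (q @ r)) b" by simp
    from homology_move.cancel[OF this]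
    show "homology_move (a, l @ (p @ [e, arev e] @ q) @ r, b) (a, l @ (p @ q) @ r, b)" by simp
  qed
next
  case (swap x p v l m q y)
  show ?thesis
  proof (rule that[OF swap(1,2)])
    fix a l' r b assume "awalk a l' x" "awalk y r b"
    then have "awalk a (l' @ p) v" "awalk v (q @ r) b"
      using swap awalk_appendI by blast+
    from homology_move.swap[OF this(1) swap(4,5) this(2)]
    show "homology_move (a, l' @ (p @ l @ m @ q) @ r, b) (a, l' @ (p @ m @ l @ q) @ r, b)" by simp
  qed
qed

text \<open>
  The conclusion keeps track of the end points because the intermediate triples of a chain of moves
  are arbitrary: that they share their end points is part of the induction.
\<close>

lemma homologous_append_aux:
  assumes "homologous (x, p, y) \<delta>" "awalk a l x" "awalk y r b"
  shows "\<exists>q. \<delta> = (x, q, y) \<and> homologous (a, l @ p @ r, b) (a, l @ q @ r, b)"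
  using assms(1) unfolding homologous_def
proof (induction rule: equivclp_induct)
  case base
  then show ?case by (auto simp: homologous_def)
next
  case (step \<delta> \<epsilon>)
  then obtain q where q: "\<delta> = (x, q, y)"
    "equivclp homology_move (a, l @ p @ r, b) (a, l @ q @ r, b)" by blast
  from step(2) show ?case
    by (elim disjE homology_move_append)
      (use q assms(2,3) in \<open>auto intro: equivclp_into_equivclp\<close>)
qed

lemma homologous_append:
  assumes "homologous (x, p, y) (x, q, y)" "awalk a l x" "awalk y r b"
  shows "homologous (a, l @ p @ r, b) (a, l @ q @ r, b)"
  using homologous_append_aux[OF assms] by auto

lemma homologous_inv_path_right:
  "awalk x p y \<Longrightarrow> homologous (x, p @ inv_path p, x) (x, [], x)"
proof (induction p arbitrary: x)
  case (Cons e p)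
  then have e: "e \<in> arcs G" "x = tail G e" "awalk (head G e) p y" by auto
  have "homologous (x, [e] @ (p @ inv_path p) @ [arev e], x) (x, [e] @ [] @ [arev e], x)"
    by (rule homologous_append[OF Cons.IH[OF e(3)]]) (use e in auto)
  also have "homologous \<dots> (x, [], x)"
    unfolding homologous_def using homology_move.cancel[of x "[]" e "[]" x] e
    by (auto intro: r_into_equivclp)
  finally show ?case by simp
qed simp

lemma homologous_inv_path_left:
  "awalk x p y \<Longrightarrow> homologous (y, inv_path p @ p, y) (y, [], y)"
  using homologous_inv_path_right[of y "inv_path p" x] by (simp add: awalk_inv_path)

lemma homologous_swap:
  assumes "awalk x l x" "awalk x m x" "awalk x r y"
  shows "homologous (x, l @ m @ r, y) (x, m @ l @ r, y)"
  unfolding homologous_def using homology_move.swap[of x "[]" x l m r y] assms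
    awalk_ends_in_verts[OF assms(1)]
  by (auto intro: r_into_equivclp)

section \<open>Paths with the same chain are homologous\<close>

text \<open>
  The moves exchange only loops with the same base point. To be able to reorder the letters of a word, each edge is therefore completed to a loop at \<open>x\<^sub>0\<close>, by means of a path \<open>T v\<close>
  from \<open>x\<^sub>0\<close> to each vertex \<open>v\<close>.
\<close>

definition base_paths :: "'a \<Rightarrow> ('a \<Rightarrow> 'b list) \<Rightarrow> bool" where
  "base_paths x\<^sub>0 T \<longleftrightarrow> x\<^sub>0 \<in> verts G \<and> (\<forall>v \<in> verts G. awalk x\<^sub>0 (T v) v)"

definition based_loop :: "('a \<Rightarrow> 'b list) \<Rightarrow> 'b \<Rightarrow> 'b list" where
  "based_loop T e = T (tail G e) @ [e] @ inv_path (T (head G e))"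

abbreviation based_loops :: "('a \<Rightarrow> 'b list) \<Rightarrow> 'b list \<Rightarrow> 'b list" where
  "based_loops T es \<equiv> concat (map (based_loop T) es)"

lemma connected_base_paths:
  assumes "Digraph_Component.connected G" "x\<^sub>0 \<in> verts G"
  obtains T where "base_paths x\<^sub>0 T" "T x\<^sub>0 = []"
proof -
  have "\<exists>p. awalk x\<^sub>0 p v" if "v \<in> verts G" for v
    using symmetric_connected_imp_strongly_connected[OF sym_arcs assms(1)] assms(2) that
    by (auto simp: strongly_connected_def reachable_awalk)
  then obtain P where P: "\<And>v. v \<in> verts G \<Longrightarrow> awalk x\<^sub>0 (P v) v" by metis
  show ?thesis
    by (rule that[of "P(x\<^sub>0 := [])"]) (use P assms(2) in \<open>auto simp: base_paths_def\<close>)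
qed

lemma awalk_based_loop:
  assumes "base_paths x\<^sub>0 T" "e \<in> arcs G"
  shows "awalk x\<^sub>0 (based_loop T e) x\<^sub>0"
proof -
  have "awalk x\<^sub>0 (T (tail G e)) (tail G e)" "awalk (tail G e) [e] (head G e)"
    "awalk (head G e) (inv_path (T (head G e))) x\<^sub>0"
    using assms by (auto simp: base_paths_def awalk_inv_path)
  then show ?thesis
    unfolding based_loop_def by (metis awalk_appendI)
qed

lemma awalk_based_loops:
  assumes "base_paths x\<^sub>0 T" "set es \<subseteq> arcs G"
  shows "awalk x\<^sub>0 (based_loops T es) x\<^sub>0"
  using assms(2)
proof (induction es)
  case Nil
  then show ?case using assms(1) by (simp add: base_paths_def)
next
  case (Cons e es)
  then show ?case using awalk_appendI[OF awalk_based_loop[OF assms(1)]] by simp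
qed

lemma based_loop_arev: "e \<in> arcs G \<Longrightarrow> based_loop T (arev e) = inv_path (based_loop T e)"
  by (simp add: based_loop_def)

text \<open>
  Inserting \<open>inv_path (T v) @ T v\<close> at each vertex \<open>v\<close> that the path visits turns the path into
  a product of based loops.
\<close>

lemma homologous_based_loops:
  assumes T: "base_paths x\<^sub>0 T"
  shows "awalk u p v \<Longrightarrow> homologous (x\<^sub>0, T u @ p, v) (x\<^sub>0, based_loops T p @ T v, v)"
proof (induction p arbitrary: u)
  case (Cons e p)
  let ?w = "head G e"
  from Cons.prems have e: "e \<in> arcs G" "u = tail G e" "awalk ?w p v" by auto
  have Tu: "awalk x\<^sub>0 (T u @ [e]) ?w" and Tw: "awalk x\<^sub>0 (T ?w) ?w" and v: "v \<in> verts G"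
    using T e awalk_ends_in_verts[OF e(3)]
    by (auto simp: base_paths_def intro!: awalk_appendI[of _ _ "tail G e"])
  have "homologous (x\<^sub>0, (T u @ [e]) @ [] @ p, v)
      (x\<^sub>0, (T u @ [e]) @ (inv_path (T ?w) @ T ?w) @ p, v)"
    by (rule homologous_append[OF homologous_sym[OF homologous_inv_path_left[OF Tw]] Tu e(3)])
  also have "(T u @ [e]) @ (inv_path (T ?w) @ T ?w) @ p = based_loop T e @ (T ?w @ p) @ []"
    by (simp add: based_loop_def e)
  also have "homologous (x\<^sub>0, based_loop T e @ (T ?w @ p) @ [], v)
      (x\<^sub>0, based_loop T e @ (based_loops T p @ T v) @ [], v)"
    by (rule homologous_append[OF Cons.IH[OF e(3)]]) (use T e v awalk_based_loop in \<open>auto\<close>)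
  finally show ?case by simp
qed simp

text \<open>
  The product of the based loops of a word is a path even if the word itself is not. This is why the
  next lemmas can treat arbitrary words: after two letters have cancelled, the remaining word need
  not be a path.
\<close>

abbreviation word_chain :: "'b list \<Rightarrow> 'b \<Rightarrow>\<^sub>0 real" where
  "word_chain p \<equiv> \<Sum>e \<leftarrow> p. edge_chain e"

lemma word_chain_inv_path: "word_chain (inv_path p) = - word_chain p"
  by (induction p) (auto simp: edge_chain_arev)

text \<open>
  Only the letter \<open>arev e\<close> contributes negatively to the coefficient at \<open>e\<close>.
\<close>

lemma word_chain_nonneg: "arev e \<notin> set p \<Longrightarrow> 0 \<le> Poly_Mapping.lookup (word_chain p) e"
  by (induction p) (auto simp: lookup_add lookup_edge_chain)

text \<open>
  In a word with chain 0, the first letter \<open>e\<close> must be compensated by a letter \<open>arev e\<close>. The loop of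
  \<open>e\<close> can be moved next to the loop of \<open>arev e\<close>, which is its inverse, and both cancel.
\<close>

lemma based_loops_null_homologous:
  assumes T: "base_paths x\<^sub>0 T"
  shows "set es \<subseteq> arcs G \<Longrightarrow> word_chain es = 0 \<Longrightarrow>
    homologous (x\<^sub>0, based_loops T es, x\<^sub>0) (x\<^sub>0, [], x\<^sub>0)"
proof (induction es rule: length_induct)
  case (1 es)
  show ?case
  proof (cases es)
    case (Cons e q)
    have "arev e \<in> set q"
    proof (rule ccontr)
      assume "arev e \<notin> set q"
      then have "0 \<le> Poly_Mapping.lookup (word_chain q) e" by (rule word_chain_nonneg)
      moreover have "Poly_Mapping.lookup (word_chain es) e = 0" using 1 by simp
      moreover have "arev e \<noteq> e" using 1 Cons arev_neq by simp
      ultimately show False by (simp add: Cons lookup_add lookup_edge_chain)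
    qed
    then obtain q1 q2 where q: "q = q1 @ arev e # q2" by (meson split_list)
    let ?L = "based_loop T e" and ?M = "based_loops T"
    have arcs: "e \<in> arcs G" "set q1 \<subseteq> arcs G" "set q2 \<subseteq> arcs G" using 1 Cons q by auto
    have x0: "x\<^sub>0 \<in> verts G" using T by (simp add: base_paths_def)
    have L: "awalk x\<^sub>0 ?L x\<^sub>0" "awalk x\<^sub>0 (inv_path ?L) x\<^sub>0"
      and M: "awalk x\<^sub>0 (?M q1) x\<^sub>0" "awalk x\<^sub>0 (?M q2) x\<^sub>0"
      using awalk_based_loop[OF T] awalk_based_loops[OF T] arcs awalk_inv_path by auto
    have "homologous (x\<^sub>0, ?L @ ?M q1 @ (inv_path ?L @ ?M q2), x\<^sub>0)
        (x\<^sub>0, ?M q1 @ ?L @ (inv_path ?L @ ?M q2), x\<^sub>0)"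
      by (rule homologous_swap) (use L M awalk_appendI in auto)
    also have "homologous (x\<^sub>0, ?M q1 @ ?L @ (inv_path ?L @ ?M q2), x\<^sub>0)
        (x\<^sub>0, ?M q1 @ [] @ ?M q2, x\<^sub>0)"
      using homologous_append[OF homologous_inv_path_right[OF L(1)] M] by simp
    also have "?M q1 @ [] @ ?M q2 = ?M (q1 @ q2)" by simp
    also have "homologous (x\<^sub>0, ?M (q1 @ q2), x\<^sub>0) (x\<^sub>0, [], x\<^sub>0)"
      using 1(1)[rule_format, of "q1 @ q2"] 1(3) arcs
      by (simp add: Cons q edge_chain_arev algebra_simps)
    finally show ?thesis using arcs by (simp add: Cons q based_loop_arev)
  qed simp
qed

text \<open>
  In terms of products of based loops, \<open>p\<close> is homologous to \<open>p q\<inverse> q\<close>, and the words \<open>p q\<inverse>\<close> and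
  \<open>q\<inverse> q\<close> have chain 0. The base path to \<open>x\<close> itself is chosen trivial so that the products
  represent \<open>p\<close> and \<open>q\<close> and not their translates by a loop.
\<close>

lemma homologous_if_chain_eq:
  assumes conn: "Digraph_Component.connected G"
    and p: "awalk x p y" and q: "awalk x q y"
    and eq: "path_chain (x, p, y) = path_chain (x, q, y)"
  shows "homologous (x, p, y) (x, q, y)"
proof -
  have xy: "x \<in> verts G" "y \<in> verts G" using p awalk_ends_in_verts by auto
  obtain T where T: "base_paths x T" "T x = []"
    using connected_base_paths[OF conn xy(1)] by blast
  let ?M = "based_loops T"
  have arcs: "set p \<subseteq> arcs G" "set q \<subseteq> arcs G" "set (inv_path q) \<subseteq> arcs G"
    using p q awalk_inv_path[OF q] by (auto simp: awalk_def)
  have Ty: "awalk x (T y) y" using T xy by (simp add: base_paths_def)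
  have null: "homologous (x, ?M (r @ inv_path q), x) (x, [], x)"
      if "set r \<subseteq> arcs G" "word_chain r = word_chain q" for r
    by (rule based_loops_null_homologous[OF T(1)]) (use that arcs in \<open>auto simp: word_chain_inv_path\<close>)
  have null': "homologous (x, ?M (inv_path q @ q), x) (x, [], x)"
    by (rule based_loops_null_homologous[OF T(1)]) (use arcs in \<open>auto simp: word_chain_inv_path\<close>)
  have "homologous (x, p, y) (x, ?M p @ T y, y)"
    using homologous_based_loops[OF T(1) p] T(2) by simp
  also have "homologous \<dots> (x, ?M p @ ?M (inv_path q @ q) @ T y, y)"
    using homologous_append[OF homologous_sym[OF null'] awalk_based_loops[OF T(1) arcs(1)] Ty]
    by simp
  also have "?M p @ ?M (inv_path q @ q) @ T y = [] @ ?M (p @ inv_path q) @ (?M q @ T y)" by simp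
  also have "homologous (x, [] @ ?M (p @ inv_path q) @ (?M q @ T y), y)
      (x, [] @ [] @ (?M q @ T y), y)"
    by (rule homologous_append[OF null])
      (use arcs eq xy Ty awalk_based_loops[OF T(1) arcs(2)] in \<open>auto intro: awalk_appendI\<close>)
  also have "homologous (x, [] @ [] @ (?M q @ T y), y) (x, q, y)"
    using homologous_sym[OF homologous_based_loops[OF T(1) q]] T(2) by simp
  finally show ?thesis .
qed

section \<open>Pairing chains with functions on the edges\<close>

text \<open>
  In an infinite graph, the coboundary of a function on the vertices need not have finite support,
  so it is not a chain. Chains are therefore paired with arbitrary functions on the edges. The inner
  product is a special case, and the flow of a chain through a cut is the pairing with the coboundary
  of the indicator function of the set on the far side of the cut. The factor 1/2 counts each pair of
  inverse edges once.
\<close>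

definition pairing :: "('b \<Rightarrow> real) \<Rightarrow> ('b \<Rightarrow>\<^sub>0 real) \<Rightarrow> real" where
  "pairing h c = (\<Sum>e \<in> Poly_Mapping.keys c. Poly_Mapping.lookup c e * h e) / 2"

definition coboundary :: "('a \<Rightarrow> real) \<Rightarrow> 'b \<Rightarrow> real" where
  "coboundary f e = f (head G e) - f (tail G e)"

lemma coboundary_arev: "e \<in> arcs G \<Longrightarrow> coboundary f (arev e) = - coboundary f e"
  by (simp add: coboundary_def)

lemma chain_inner_eq_pairing: "chain_inner c d = pairing (Poly_Mapping.lookup d) c"
  by (simp add: chain_inner_def pairing_def)

lemma pairing_superset:
  assumes "finite S" "Poly_Mapping.keys c \<subseteq> S"
  shows "pairing h c = (\<Sum>e \<in> S. Poly_Mapping.lookup c e * h e) / 2"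
  unfolding pairing_def using assms by (auto intro!: sum.mono_neutral_left simp: in_keys_iff)

lemma pairing_zero [simp]: "pairing h 0 = 0"
  by (simp add: pairing_def)

lemma pairing_add: "pairing h (c + d) = pairing h c + pairing h d"
proof -
  let ?S = "Poly_Mapping.keys c \<union> Poly_Mapping.keys d"
  have "pairing h (c + d) = (\<Sum>e \<in> ?S. Poly_Mapping.lookup (c + d) e * h e) / 2"
    by (rule pairing_superset) (use Poly_Mapping.keys_add[of c d] in auto)
  moreover have "pairing h c = (\<Sum>e \<in> ?S. Poly_Mapping.lookup c e * h e) / 2"
    "pairing h d = (\<Sum>e \<in> ?S. Poly_Mapping.lookup d e * h e) / 2"
    by (rule pairing_superset; simp)+
  ultimately show ?thesis
    by (simp add: lookup_add distrib_right sum.distrib add_divide_distrib)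
qed

lemma pairing_uminus: "pairing h (- c) = - pairing h c"
  using pairing_add[of h c "- c"] by simp

lemma pairing_diff: "pairing h (c - d) = pairing h c - pairing h d"
  using pairing_add[of h c "- d"] by (simp add: pairing_uminus)

lemma pairing_edge_chain:
  assumes "e \<in> arcs G" "h (arev e) = - h e"
  shows "pairing h (edge_chain e) = h e"
  using assms arev_neq[OF assms(1)] by (simp add: pairing_def keys_edge_chain lookup_edge_chain)

text \<open>
  The differences of \<open>f\<close> along the path telescope.
\<close>

lemma pairing_coboundary_path_chain:
  "awalk x p y \<Longrightarrow> pairing (coboundary f) (path_chain (x, p, y)) = f y - f x"
  by (induction p arbitrary: x)
    (auto simp: pairing_add pairing_edge_chain coboundary_arev coboundary_def)

text \<open>
  Coboundary and boundary are adjoint. The finite set \<open>W\<close> only has to contain the end points of the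
  edges in the support of \<open>c\<close>.
\<close>

lemma pairing_coboundary_eq_boundary:
  assumes "finite W" "head G ` Poly_Mapping.keys c \<subseteq> W" "tail G ` Poly_Mapping.keys c \<subseteq> W"
  shows "pairing (coboundary f) c = (\<Sum>v \<in> W. f v * Poly_Mapping.lookup (boundary c) v)"
proof -
  have "(\<Sum>v \<in> W. f v * Poly_Mapping.lookup (boundary c) v)
      = (\<Sum>e \<in> Poly_Mapping.keys c. \<Sum>v \<in> W.
          f v * ((Poly_Mapping.lookup c e / 2 when head G e = v)
            - (Poly_Mapping.lookup c e / 2 when tail G e = v)))"
    by (subst sum.swap)
      (simp add: boundary_def lookup_sum lookup_minus lookup_single sum_distrib_left)
  also have "\<dots> = (\<Sum>e \<in> Poly_Mapping.keys c. Poly_Mapping.lookup c e * coboundary f e / 2)"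
  proof (rule sum.cong[OF refl])
    fix e assume "e \<in> Poly_Mapping.keys c"
    then have "head G e \<in> W" "tail G e \<in> W" using assms by auto
    moreover have delta: "(\<Sum>v \<in> W. f v * (r when w = v)) = f w * r" if "w \<in> W" for w r
      using that assms(1) by (simp add: when_def if_distrib sum.delta cong: if_cong)
    ultimately show "(\<Sum>v \<in> W. f v * ((Poly_Mapping.lookup c e / 2 when head G e = v)
          - (Poly_Mapping.lookup c e / 2 when tail G e = v)))
        = Poly_Mapping.lookup c e * coboundary f e / 2"
      by (simp add: right_diff_distrib sum_subtractf coboundary_def field_simps)
  qed
  finally show ?thesis by (simp add: pairing_def sum_divide_distrib)
qed

text \<open>
  Cycles are the chains that are orthogonal to all coboundaries; the coboundary of the indicator
  function of a vertex reads off one coefficient of the boundary.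
\<close>

lemma boundary_eq_0_iff: "boundary c = 0 \<longleftrightarrow> (\<forall>f. pairing (coboundary f) c = 0)"
proof
  let ?W = "head G ` Poly_Mapping.keys c \<union> tail G ` Poly_Mapping.keys c"
  assume "boundary c = 0"
  then show "\<forall>f. pairing (coboundary f) c = 0"
    using pairing_coboundary_eq_boundary[of ?W c] by simp
next
  assume all: "\<forall>f. pairing (coboundary f) c = 0"
  show "boundary c = 0"
  proof (rule poly_mapping_eqI)
    fix v
    let ?W = "insert v (head G ` Poly_Mapping.keys c \<union> tail G ` Poly_Mapping.keys c)"
    have "(\<Sum>w \<in> ?W. of_bool (w = v) * Poly_Mapping.lookup (boundary c) w) = 0"
      using all pairing_coboundary_eq_boundary[of ?W c "\<lambda>w. of_bool (w = v)"] by auto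
    then show "Poly_Mapping.lookup (boundary c) v = Poly_Mapping.lookup 0 v"
      by (simp add: sum_of_bool_mult_eq)
  qed
qed

lemma C1_add: "c \<in> C1 \<Longrightarrow> d \<in> C1 \<Longrightarrow> c + d \<in> C1"
  using Poly_Mapping.keys_add[of c d] by (auto simp: C1_def lookup_add)

lemma C1_diff: "c \<in> C1 \<Longrightarrow> d \<in> C1 \<Longrightarrow> c - d \<in> C1"
  using keys_diff[of c d] by (auto simp: C1_def lookup_minus)

lemma Z1_iff: "z \<in> Z1 \<longleftrightarrow> z \<in> C1 \<and> (\<forall>f. pairing (coboundary f) z = 0)"
  by (simp add: Z1_def boundary_eq_0_iff)

lemma Z1_diff: "c \<in> Z1 \<Longrightarrow> d \<in> Z1 \<Longrightarrow> c - d \<in> Z1"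
  by (simp add: Z1_iff C1_diff pairing_diff)

lemma path_chain_in_C1: "set p \<subseteq> arcs G \<Longrightarrow> path_chain (x, p, y) \<in> C1"
proof (induction p)
  case Nil
  show ?case by (simp add: C1_def)
next
  case (Cons e p)
  then show ?case by (simp add: C1_add edge_chain_in_C1)
qed

lemma lookup_path_chain_in_Ints: "Poly_Mapping.lookup (path_chain (x, p, y)) e \<in> \<int>"
  by (induction p) (auto simp: lookup_add lookup_edge_chain)

lemma chain_inner_self_eq_0:
  assumes "chain_inner c c = 0"
  shows "c = 0"
proof (rule poly_mapping_eqI)
  fix e
  have "(\<Sum>e \<in> Poly_Mapping.keys c. Poly_Mapping.lookup c e * Poly_Mapping.lookup c e) = 0"
    using assms by (simp add: chain_inner_def)
  then show "Poly_Mapping.lookup c e = Poly_Mapping.lookup 0 e"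
    by (cases "e \<in> Poly_Mapping.keys c") (simp_all add: sum_nonneg_eq_0_iff in_keys_iff)
qed

lemma chain_inner_diff_left: "chain_inner (c - c') d = chain_inner c d - chain_inner c' d"
  by (simp add: chain_inner_eq_pairing pairing_diff)

lemma chain_inner_add_right: "chain_inner c (d + d') = chain_inner c d + chain_inner c d'"
  by (simp add: chain_inner_def lookup_add distrib_left sum.distrib add_divide_distrib)

lemma chain_inner_diff_right: "chain_inner c (d - d') = chain_inner c d - chain_inner c d'"
  by (simp add: chain_inner_def lookup_minus right_diff_distrib sum_subtractf diff_divide_distrib)

lemma chain_inner_edge_chain_left:
  assumes "e \<in> arcs G" "d \<in> C1"
  shows "chain_inner (edge_chain e) d = Poly_Mapping.lookup d e"
  unfolding chain_inner_eq_pairing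
  using assms by (intro pairing_edge_chain) (auto simp: C1_def)

lemma chain_inner_edge_chain_right:
  assumes "e \<in> arcs G" "c \<in> C1"
  shows "chain_inner c (edge_chain e) = Poly_Mapping.lookup c e"
proof -
  let ?S = "Poly_Mapping.keys c \<union> {e, arev e}"
  have neq: "arev e \<noteq> e" using assms(1) by (rule arev_neq)
  have "chain_inner c (edge_chain e) = (\<Sum>a \<in> ?S.
      Poly_Mapping.lookup (edge_chain e) a * Poly_Mapping.lookup c a) / 2"
    by (subst chain_inner_superset[of ?S]) (auto simp: mult.commute)
  also have "\<dots> = chain_inner (edge_chain e) c"
    using assms by (subst chain_inner_superset[of ?S]) (auto simp: keys_edge_chain)
  finally show ?thesis using assms by (simp add: chain_inner_edge_chain_left)
qed

section \<open>A bridge makes two atoms coincide\<close>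

text \<open>
  The flow of a cycle through any cut is zero, and through the cut given by a bridge it is, up to
  sign, the coefficient at the bridge.
\<close>

lemma lookup_Z1_bridge:
  assumes conn: "Digraph_Component.connected G" and e: "bridge e" and z: "z \<in> Z1"
  shows "Poly_Mapping.lookup z e = 0"
proof -
  obtain S where eG: "e \<in> arcs G" and eS: "(head G e \<in> S) \<noteq> (tail G e \<in> S)"
    and S: "\<And>a. a \<in> arcs G - {e, arev e} \<Longrightarrow> head G a \<in> S \<longleftrightarrow> tail G a \<in> S"
    using e unfolding bridge_iff_cut[OF conn] by blast
  let ?f = "\<lambda>v. of_bool (v \<in> S) :: real"
  let ?K = "Poly_Mapping.keys z \<union> {e, arev e}"
  have K: "?K \<subseteq> arcs G" and anti: "Poly_Mapping.lookup z (arev e) = - Poly_Mapping.lookup z e"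
    using z eG by (auto simp: Z1_iff C1_def)
  have "0 = (\<Sum>a \<in> ?K. Poly_Mapping.lookup z a * coboundary ?f a) / 2"
    using z pairing_superset[of ?K z "coboundary ?f", OF _ Un_upper1] by (simp add: Z1_iff)
  also have "(\<Sum>a \<in> ?K. Poly_Mapping.lookup z a * coboundary ?f a)
      = (\<Sum>a \<in> {e, arev e}. Poly_Mapping.lookup z a * coboundary ?f a)"
  proof (rule sum.mono_neutral_right)
    show "\<forall>a \<in> ?K - {e, arev e}. Poly_Mapping.lookup z a * coboundary ?f a = 0"
      using K S by (auto simp: coboundary_def)
  qed auto
  also have "\<dots> = 2 * Poly_Mapping.lookup z e * coboundary ?f e"
    using eG arev_neq[OF eG] by (simp add: coboundary_arev anti)
  finally show ?thesis using eS by (auto simp: coboundary_def split: if_splits)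
qed

text \<open>
  For a path \<open>p\<close> from \<open>x\<^sub>0\<close> to the tail of the bridge \<open>e\<close>, the paths \<open>p\<close> and \<open>p @ [e]\<close> have
  chains that differ by \<open>e\<close>, and \<open>e\<close> is orthogonal to all cycles.
\<close>

lemma bridge_collapses_atoms:
  assumes conn: "Digraph_Component.connected G" and x0: "x\<^sub>0 \<in> verts G"
    and \<pi>: "orthogonal_projection \<pi>" and e: "bridge e"
  shows "\<not> inj_on (atom_position \<pi>) (atoms x\<^sub>0)"
proof -
  have eG: "e \<in> arcs G" using e by (simp add: bridge_def)
  obtain T where T: "base_paths x\<^sub>0 T" using connected_base_paths[OF conn x0] by blast
  let ?p = "T (tail G e)"
  have p: "awalk x\<^sub>0 ?p (tail G e)" using T eG by (auto simp: base_paths_def)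
  then have pe: "awalk x\<^sub>0 (?p @ [e]) (head G e)" using eG by (auto intro: awalk_appendI)
  define \<gamma> where "\<gamma> = (x\<^sub>0, ?p, tail G e)"
  define \<delta> where "\<delta> = (x\<^sub>0, ?p @ [e], head G e)"
  have chain: "path_chain \<delta> - path_chain \<gamma> = edge_chain e" by (simp add: \<gamma>_def \<delta>_def)
  have C1: "path_chain \<gamma> \<in> C1" "path_chain \<delta> \<in> C1"
    using path_chain_in_C1 p pe by (auto simp: \<gamma>_def \<delta>_def awalk_def simp del: path_chain.simps)
  have "path_chain \<delta> \<noteq> path_chain \<gamma>"
    using chain keys_edge_chain[OF eG] by auto
  then have neq: "homology_class \<delta> \<noteq> homology_class \<gamma>"
    unfolding homology_class_eq_iff by (metis path_chain_homologous)
  let ?d = "\<pi> (path_chain \<delta>) - \<pi> (path_chain \<gamma>)"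
  have d: "?d \<in> Z1" using \<pi> C1 by (simp add: orthogonal_projection_def Z1_diff)
  \<comment> \<open>\<open>?d\<close> is the projection of the chain of \<open>e\<close>, so it is orthogonal even to itself.\<close>
  have "chain_inner (path_chain \<delta> - \<pi> (path_chain \<delta>)) ?d = 0"
    "chain_inner (path_chain \<gamma> - \<pi> (path_chain \<gamma>)) ?d = 0"
    using \<pi> C1 d by (auto simp: orthogonal_projection_def)
  then have "chain_inner ?d ?d = chain_inner (path_chain \<delta> - path_chain \<gamma>) ?d"
    by (simp add: chain_inner_diff_left)
  also have "\<dots> = 0"
    using d eG lookup_Z1_bridge[OF conn e d]
    by (simp add: chain chain_inner_edge_chain_left Z1_iff)
  finally have "?d = 0" by (rule chain_inner_self_eq_0)
  then have "atom_position \<pi> (homology_class \<delta>) = atom_position \<pi> (homology_class \<gamma>)"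
    by (simp add: atom_position_homology_class)
  moreover have "homology_class \<delta> \<in> atoms x\<^sub>0" "homology_class \<gamma> \<in> atoms x\<^sub>0"
    using p pe by (auto simp: atoms_def \<gamma>_def \<delta>_def)
  ultimately show ?thesis using neq by (auto dest: inj_onD)
qed

section \<open>Without bridges the atoms are separated\<close>

text \<open>
  The potential at \<open>v\<close> is the inner product of \<open>c\<close> with the chain of any path from a fixed vertex to
  \<open>v\<close>. Going to the tail of \<open>e\<close>, along \<open>e\<close> and back from the head of \<open>e\<close> is a cycle, so the
  potential changes along \<open>e\<close> by the inner product of \<open>c\<close> with \<open>e\<close>.
\<close>

lemma orthogonal_chain_potential:
  assumes conn: "Digraph_Component.connected G" and c: "c \<in> C1"
    and orth: "\<And>z. z \<in> Z1 \<Longrightarrow> chain_inner c z = 0"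
  obtains f where "\<And>e. e \<in> arcs G \<Longrightarrow> Poly_Mapping.lookup c e = coboundary f e"
proof -
  obtain x where x: "x \<in> verts G" using conn by (auto simp: connected_iff_cut)
  obtain T where T: "base_paths x T" using connected_base_paths[OF conn x] by blast
  have walk: "awalk x (T v) v" if "v \<in> verts G" for v using T that by (simp add: base_paths_def)
  define t where "t v = path_chain (x, T v, v)" for v
  define f where "f v = chain_inner c (t v)" for v
  show ?thesis
  proof (rule that[of f])
    fix e assume e: "e \<in> arcs G"
    then have ends: "head G e \<in> verts G" "tail G e \<in> verts G" by auto
    let ?z = "t (tail G e) + edge_chain e - t (head G e)"
    have "t v \<in> C1" if "v \<in> verts G" for v
      unfolding t_def using walk[OF that] by (intro path_chain_in_C1) (auto simp: awalk_def)
    moreover have "pairing (coboundary g) (t v) = g v - g x" if "v \<in> verts G" for g v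
      unfolding t_def using walk[OF that] by (rule pairing_coboundary_path_chain)
    ultimately have "?z \<in> Z1"
      using ends e
      by (simp add: Z1_iff C1_add C1_diff edge_chain_in_C1 pairing_add pairing_diff
          pairing_edge_chain coboundary_arev) (simp add: coboundary_def)
    then have "chain_inner c ?z = 0" by (rule orth)
    then show "Poly_Mapping.lookup c e = coboundary f e"
      by (simp add: f_def coboundary_def chain_inner_add_right chain_inner_diff_right
          chain_inner_edge_chain_right[OF e c])
  qed
qed

text \<open>
  The assumption \<open>bd\<close> says that \<open>\<partial>c = y - x\<close>. Integrality is essential: a non-integral chain could
  distribute the unit flow over several edges of the cut.
\<close>

lemma bridgeless_orthogonal_chain_eq_0:
  assumes conn: "Digraph_Component.connected G" and nb: "bridgeless"
    and c: "c \<in> C1" and int: "\<And>e. Poly_Mapping.lookup c e \<in> \<int>"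
    and bd: "\<And>g. pairing (coboundary g) c = g y - g x"
    and orth: "\<And>z. z \<in> Z1 \<Longrightarrow> chain_inner c z = 0"
  shows "c = 0"
proof (rule ccontr)
  assume "c \<noteq> 0"
  obtain f where f: "\<And>e. e \<in> arcs G \<Longrightarrow> Poly_Mapping.lookup c e = coboundary f e"
    using orthogonal_chain_potential[OF conn c orth] by blast
  have K: "Poly_Mapping.keys c \<subseteq> arcs G" using c by (simp add: C1_def)
  have "chain_inner c c = pairing (coboundary f) c"
    unfolding chain_inner_eq_pairing pairing_def using K f by (auto intro!: sum.cong)
  also have "\<dots> = f y - f x" by (rule bd)
  finally have "chain_inner c c = f y - f x" .
  moreover have "chain_inner c c \<ge> 0" unfolding chain_inner_def by (simp add: sum_nonneg)
  moreover have "chain_inner c c \<noteq> 0" using \<open>c \<noteq> 0\<close> chain_inner_self_eq_0 by blast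
  ultimately have fxy: "f x < f y" by simp
  \<comment> \<open>\<open>g\<close> is the indicator of the side of \<open>y\<close> in the cut, and \<open>h e\<close> the flow of \<open>c\<close> through the cut
    along \<open>e\<close>. It is the same for \<open>arev e\<close>, so the unit flow appears as a sum of 2.\<close>
  define g :: "'a \<Rightarrow> real" where "g v = (if f v \<le> f x then 0 else 1)" for v
  define h where "h e = Poly_Mapping.lookup c e * coboundary g e" for e
  have flux: "(\<Sum>e \<in> Poly_Mapping.keys c. h e) = 2"
    using bd[of g] fxy by (simp add: pairing_def h_def g_def)
  have cross: "e \<in> Poly_Mapping.keys c \<and> h e \<ge> 1"
    if e: "e \<in> arcs G" "g (head G e) \<noteq> g (tail G e)" for e
  proof -
    have ne: "Poly_Mapping.lookup c e \<noteq> 0"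
      using e by (auto simp: f coboundary_def g_def split: if_splits)
    then have "1 \<le> \<bar>Poly_Mapping.lookup c e\<bar>" using int Ints_nonzero_abs_ge1 by blast
    moreover have "h e = \<bar>Poly_Mapping.lookup c e\<bar>"
      using e by (auto simp: h_def f coboundary_def g_def split: if_splits)
    ultimately show ?thesis using ne by (simp add: in_keys_iff)
  qed
  have nonneg: "h e \<ge> 0" if "e \<in> Poly_Mapping.keys c" for e
    using cross[of e] that K by (cases "g (head G e) = g (tail G e)") (auto simp: h_def coboundary_def)
  obtain e where "e \<in> Poly_Mapping.keys c" "h e \<noteq> 0"
    using flux by (metis sum.neutral zero_neq_numeral)
  then have e: "e \<in> arcs G" "g (head G e) \<noteq> g (tail G e)"
    using K by (auto simp: h_def coboundary_def)
  \<comment> \<open>A third crossing edge would raise the sum of the flows to at least 3.\<close>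
  have only: "g (head G a) = g (tail G a)" if a: "a \<in> arcs G - {e, arev e}" for a
  proof (rule ccontr)
    assume "g (head G a) \<noteq> g (tail G a)"
    then have "h a \<ge> 1" "a \<in> Poly_Mapping.keys c" using cross a by auto
    moreover have "h e \<ge> 1" "e \<in> Poly_Mapping.keys c" using cross e by auto
    moreover have "h (arev e) \<ge> 1" "arev e \<in> Poly_Mapping.keys c" using cross[of "arev e"] e by auto
    ultimately have sub: "{a, e, arev e} \<subseteq> Poly_Mapping.keys c" and "h a + h e + h (arev e) \<ge> 3" by auto
    moreover have "(\<Sum>b \<in> {a, e, arev e}. h b) = h a + h e + h (arev e)"
      using a arev_neq[OF e(1)] by simp
    moreover have "(\<Sum>b \<in> {a, e, arev e}. h b) \<le> (\<Sum>b \<in> Poly_Mapping.keys c. h b)"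
      by (rule sum_mono2) (use sub nonneg in auto)
    ultimately show False using flux by simp
  qed
  have "bridge e"
    unfolding bridge_iff_cut[OF conn]
    using e only by (intro conjI exI[of _ "{v. g v = 0}"]) (auto simp: g_def split: if_splits)
  then show False using nb e by (simp add: bridgeless_def)
qed

text \<open>
  For two atoms at the same position, the difference of their chains is orthogonal to all cycles,
  hence 0, so that its boundary forces the end points to agree.
\<close>

lemma bridgeless_inj_on_atoms:
  assumes conn: "Digraph_Component.connected G" and nb: "bridgeless"
    and \<pi>: "orthogonal_projection \<pi>"
  shows "inj_on (atom_position \<pi>) (atoms x\<^sub>0)"
proof (rule inj_onI)
  fix a b assume "a \<in> atoms x\<^sub>0" "b \<in> atoms x\<^sub>0" and eq: "atom_position \<pi> a = atom_position \<pi> b"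
  then obtain p x q y where a: "a = homology_class (x\<^sub>0, p, x)" and p: "awalk x\<^sub>0 p x"
    and b: "b = homology_class (x\<^sub>0, q, y)" and q: "awalk x\<^sub>0 q y"
    by (auto simp: atoms_def)
  define c where "c = path_chain (x\<^sub>0, p, x)"
  define d where "d = path_chain (x\<^sub>0, q, y)"
  have C1: "c \<in> C1" "d \<in> C1"
    unfolding c_def d_def using p q path_chain_in_C1 by (auto simp: awalk_def simp del: path_chain.simps)
  have \<pi>eq: "\<pi> c = \<pi> d" using eq by (simp add: a b c_def d_def atom_position_homology_class del: path_chain.simps)
  have bd: "pairing (coboundary g) (d - c) = g y - g x" for g
    unfolding c_def d_def using p q by (simp add: pairing_diff pairing_coboundary_path_chain del: path_chain.simps)
  have "d - c = 0"
  proof (rule bridgeless_orthogonal_chain_eq_0[OF conn nb _ _ bd])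
    show "d - c \<in> C1" using C1 by (simp add: C1_diff)
    show "Poly_Mapping.lookup (d - c) e \<in> \<int>" for e
      unfolding c_def d_def lookup_minus by (intro Ints_diff lookup_path_chain_in_Ints)
    show "chain_inner (d - c) z = 0" if "z \<in> Z1" for z
    proof -
      have "chain_inner (c - \<pi> c) z = 0" "chain_inner (d - \<pi> d) z = 0"
        using \<pi> C1 that by (auto simp: orthogonal_projection_def)
      then show ?thesis by (simp add: chain_inner_diff_left \<pi>eq)
    qed
  qed
  then have cd: "c = d" by simp
  have "x = y" using bd[of "\<lambda>v. if v = y then 1 else 0"] by (simp add: cd split: if_splits)
  then show "a = b"
    using homologous_if_chain_eq[OF conn p, of q] q cd
    by (simp add: a b c_def d_def homology_class_eq_iff)
qed

end

theorem theorem3: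
  fixes G :: "('a, 'b) pre_digraph" and arev :: "'b \<Rightarrow> 'b" and x\<^sub>0 :: 'a
    and \<pi> :: "('b \<Rightarrow>\<^sub>0 real) \<Rightarrow> ('b \<Rightarrow>\<^sub>0 real)"
  assumes "bidirected_digraph G arev"
    and "Digraph_Component.connected G"
    and "x\<^sub>0 \<in> verts G"
    and "bidirected_digraph.orthogonal_projection G arev \<pi>"
  shows "bidirected_digraph.bridgeless G arev \<longleftrightarrow>
    inj_on (bidirected_digraph.atom_position arev \<pi>) (bidirected_digraph.atoms G arev x\<^sub>0)"
proof -
  interpret bidirected_digraph G arev by fact
  show ?thesis
    using bridge_collapses_atoms[OF assms(2-4)] bridgeless_inj_on_atoms[OF assms(2) _ assms(4)]
    by (auto simp: bridgeless_def)
qed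

end
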